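(* Let $G$ be an abelian group, regarded as a discrete group, and let $V\to BG$ be the $\mathrm{PGL}_n(\mathbb{C})$-bundle associated to a homomorphism $\rho:G\to\mathrm{PU}(n)$. Then there is a subgroup $M\subset G$ of finite index such that the restriction $V|_{BM}$ comes from a complex vector bundle of rank $n$ (equivalently, $\rho|_M$ lifts to a linear representation $M\to\mathrm{GL}_n(\mathbb C)$, and the obstruction class of $V|_{BM}$ vanishes).
   Context: $BG$ is the classifying space of the discrete group $G$ (a $K(G,1)$). For a homomorphism $\rho:G\to L$ into a Lie group $L$, the associated flat principal $L$-bundle on $BG$ is $(EG\times L)/G$ with $G$ acting diagonally. A $\mathrm{PGL}_n$-bundle comes from a vector bundle of rank $n$ if it is the projectivization of one, i.e. lifts along $\mathrm{GL}_n\to\mathrm{PGL}_n$. *)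

theory Defs
  imports "HOL-Analysis.Analysis" "HOL-Algebra.Coset"
begin

text \<open>n x n complex matrices, n = CARD('n).\<close>

definition mat_smult :: "complex \<Rightarrow> complex^'n^'n \<Rightarrow> complex^'n^'n" where
  "mat_smult c A = (\<chi> i j. c * A$i$j)"

definition adjoint_mat :: "complex^'n^'n \<Rightarrow> complex^'n^'n" where
  "adjoint_mat A = (\<chi> i j. cnj (A$j$i))"

definition unitary_mat :: "complex^'n^'n \<Rightarrow> bool" where
  "unitary_mat U \<longleftrightarrow> U ** adjoint_mat U = mat 1 \<and> adjoint_mat U ** U = mat 1"

text \<open>Equality in PGL_n(C): A and B differ by a nonzero scalar.\<close>
definition proj_eq :: "complex^'n^'n \<Rightarrow> complex^'n^'n \<Rightarrow> bool" where
  "proj_eq A B \<longleftrightarrow> (\<exists>c. c \<noteq> 0 \<and> A = mat_smult c B)"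

text \<open>A homomorphism rho : G -> PU(n), given by unitary representatives U g of rho g.\<close>
definition PU_hom :: "('g, 'b) monoid_scheme \<Rightarrow> ('g \<Rightarrow> complex^'n^'n) \<Rightarrow> bool" where
  "PU_hom G U \<longleftrightarrow> (\<forall>g\<in>carrier G. unitary_mat (U g)) \<and>
     (\<forall>g\<in>carrier G. \<forall>h\<in>carrier G. proj_eq (U (g \<otimes>\<^bsub>G\<^esub> h)) (U g ** U h))"

text \<open>A linear representation psi : M -> GL_n(C) lifting rho restricted to M.\<close>
definition GL_lift_on :: "('g, 'b) monoid_scheme \<Rightarrow> 'g set \<Rightarrow> ('g \<Rightarrow> complex^'n^'n)
    \<Rightarrow> ('g \<Rightarrow> complex^'n^'n) \<Rightarrow> bool" where
  "GL_lift_on G M U \<psi> \<longleftrightarrow> (\<forall>m\<in>M. invertible (\<psi> m) \<and> proj_eq (\<psi> m) (U m)) \<and>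
     (\<forall>m\<in>M. \<forall>m'\<in>M. \<psi> (m \<otimes>\<^bsub>G\<^esub> m') = \<psi> m ** \<psi> m')"

end

theory Submission
  imports Defs "HOL-Computational_Algebra.Fundamental_Theorem_Algebra"
begin

text \<open>Let \<open>U g\<close> be invertible representatives of \<open>\<rho> g\<close>. Since \<open>G\<close> is abelian,
  \<open>U g U h = c(g,h) U h U g\<close> for a scalar \<open>c(g,h)\<close>, which is an \<open>n\<close>-th root of unity
  (take determinants). The subgroup \<open>M\<close> of all \<open>g\<close> with \<open>c(g,-) = 1\<close> has finite index:
  \<open>c(g,-)\<close> is determined by its values on finitely many \<open>h\<close> whose \<open>U h\<close> span the linear
  span of all \<open>U h\<close>, so \<open>g \<mapsto> c(g,-)\<close> takes only finitely many values. The matrices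
  \<open>U m\<close>, \<open>m \<in> M\<close>, commute pairwise and therefore have a common eigenvector \<open>w\<close>;
  dividing \<open>U m\<close> by its eigenvalue on \<open>w\<close> turns \<open>U\<close> into a homomorphism
  \<open>M \<rightarrow> GL\<^sub>n(\<complex>)\<close> lifting \<open>\<rho>|\<^sub>M\<close>.\<close>

section \<open>Common eigenvectors of commuting matrices\<close>

text \<open>\<open>poly_mat_vec p B w\<close> is \<open>p(B) w\<close>. A nonzero \<open>p\<close> of least degree with \<open>p(B) w = 0\<close>
  has a root \<open>z\<close>, and writing \<open>p = (X - z) q\<close> makes \<open>q(B) w\<close> an eigenvector of \<open>B\<close>; it
  stays an eigenvector of every matrix that commutes with \<open>B\<close> and has \<open>w\<close> as eigenvector.\<close>

definition poly_mat_vec :: "'a::field poly \<Rightarrow> 'a^'n^'n \<Rightarrow> 'a^'n \<Rightarrow> 'a^'n" where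
  "poly_mat_vec p B w = (\<Sum>i\<le>degree p. coeff p i *s ((*v) B ^^ i) w)"

lemma poly_mat_vec_eq_sum:
  assumes "degree p \<le> K"
  shows "poly_mat_vec p B w = (\<Sum>i\<le>K. coeff p i *s ((*v) B ^^ i) w)"
  unfolding poly_mat_vec_def
  by (rule sum.mono_neutral_left) (use assms in \<open>auto intro!: coeff_eq_0 simp: not_le\<close>)

lemma poly_mat_vec_add: "poly_mat_vec (p + q) B w = poly_mat_vec p B w + poly_mat_vec q B w"
proof -
  let ?K = "max (degree p) (degree q)"
  have "degree (p + q) \<le> ?K"
    by (rule degree_add_le) auto
  then show ?thesis
    by (simp add: poly_mat_vec_eq_sum[of _ ?K] vector_sadd_rdistrib sum.distrib)
qed

lemma poly_mat_vec_smult: "poly_mat_vec (smult c p) B w = c *s poly_mat_vec p B w"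
  by (simp add: poly_mat_vec_eq_sum[of "smult c p" "degree p"] poly_mat_vec_def
      vec.scale_sum_right vector_smult_assoc)

lemma poly_mat_vec_diff: "poly_mat_vec (p - q) B w = poly_mat_vec p B w - poly_mat_vec q B w"
proof -
  have "p - q = p + smult (-1) q"
    by simp
  then show ?thesis
    by (simp only: poly_mat_vec_add poly_mat_vec_smult) (simp add: vec_eq_iff)
qed

lemma poly_mat_vec_const: "poly_mat_vec [:c:] B w = c *s w"
  by (simp add: poly_mat_vec_def)

lemma poly_mat_vec_monom: "poly_mat_vec (monom c k) B w = c *s ((*v) B ^^ k) w"
  by (simp add: poly_mat_vec_eq_sum[of _ k] degree_monom_le coeff_monom
      if_distrib[where f = "\<lambda>c. c *s _"] cong: if_cong)

lemma poly_mat_vec_0 [simp]: "poly_mat_vec 0 B w = 0"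
  by (simp add: poly_mat_vec_def)

lemma poly_mat_vec_sum: "poly_mat_vec (sum f A) B w = (\<Sum>i\<in>A. poly_mat_vec (f i) B w)"
  by (induction A rule: infinite_finite_induct) (simp_all add: poly_mat_vec_add)

lemma poly_mat_vec_pCons_0: "poly_mat_vec (pCons 0 p) B w = B *v poly_mat_vec p B w"
proof -
  have "poly_mat_vec (pCons 0 p) B w
      = (\<Sum>i\<le>Suc (degree p). coeff (pCons 0 p) i *s ((*v) B ^^ i) w)"
    by (rule poly_mat_vec_eq_sum) (rule degree_pCons_le)
  also have "\<dots> = (\<Sum>i\<le>degree p. coeff p i *s ((*v) B ^^ Suc i) w)"
    unfolding sum.atMost_Suc_shift by simp
  finally show ?thesis
    by (simp add: poly_mat_vec_def vec.sum vector_scalar_commute)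
qed

lemma poly_mat_vec_annihilator_exists:
  fixes B :: "'a::field^'n^'n"
  shows "\<exists>p. p \<noteq> 0 \<and> poly_mat_vec p B w = 0"
proof (cases "inj_on (\<lambda>i. ((*v) B ^^ i) w) {..CARD('n)}")
  case False
  then obtain i j where ij: "i \<noteq> j" "((*v) B ^^ i) w = ((*v) B ^^ j) w"
    by (auto simp: inj_on_def)
  let ?p = "monom 1 i - monom (1::'a) j"
  have "coeff ?p i = 1"
    using ij(1) by (simp add: coeff_monom)
  then have "?p \<noteq> 0"
    by (metis coeff_0 zero_neq_one)
  moreover have "poly_mat_vec ?p B w = 0"
    using ij(2) by (simp add: poly_mat_vec_diff poly_mat_vec_monom)
  ultimately show ?thesis
    by blast
next
  case True
  let ?v = "\<lambda>i. ((*v) B ^^ i) w"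
  let ?S = "?v ` {..CARD('n)}"
  have "vec.dim ?S < card ?S"
    using dim_subset_UNIV_cart_gen[of ?S] True by (simp add: card_image)
  then have "vec.dependent ?S"
    by (intro vec.dependent_biggerset_general)
  then obtain u where u: "\<exists>v\<in>?S. u v \<noteq> 0" "(\<Sum>v\<in>?S. u v *s v) = 0"
    by (auto simp: vec.dependent_finite)
  let ?p = "\<Sum>i\<le>CARD('n). monom (u (?v i)) i"
  obtain k where k: "k \<le> CARD('n)" "u (?v k) \<noteq> 0"
    using u(1) by blast
  have "coeff ?p k = u (?v k)"
    using k(1) by (simp add: coeff_sum coeff_monom)
  with k(2) have "?p \<noteq> 0"
    by auto
  moreover have "poly_mat_vec ?p B w = (\<Sum>i\<le>CARD('n). u (?v i) *s ?v i)"
    by (simp add: poly_mat_vec_sum poly_mat_vec_monom)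
  moreover have "\<dots> = 0"
    using u(2) by (simp add: sum.reindex[OF True])
  ultimately show ?thesis
    by metis
qed

lemma poly_mat_vec_eigenvector_exists:
  fixes B :: "complex^'n^'n"
  assumes "w \<noteq> 0"
  shows "\<exists>q z. poly_mat_vec q B w \<noteq> 0 \<and> B *v poly_mat_vec q B w = z *s poly_mat_vec q B w"
proof -
  obtain p where p: "p \<noteq> 0" "poly_mat_vec p B w = 0"
    and p_min: "\<And>p'. p' \<noteq> 0 \<Longrightarrow> poly_mat_vec p' B w = 0 \<Longrightarrow> degree p \<le> degree p'"
    using ex_has_least_nat[of "\<lambda>p. p \<noteq> 0 \<and> poly_mat_vec p B w = 0" _ degree]
      poly_mat_vec_annihilator_exists[of B w] by blast
  have "degree p \<noteq> 0"
  proof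
    assume "degree p = 0"
    then obtain c where "p = [:c:]"
      by (rule degree_eq_zeroE)
    with p assms show False
      by (auto simp: poly_mat_vec_const vec_eq_iff)
  qed
  then obtain z where "poly p z = 0"
    using alg_closed_imp_poly_has_root by blast
  then obtain q where pq: "p = [:-z, 1:] * q"
    by (metis dvdE dvd_iff_poly_eq_0 minus_minus)
  with p(1) have "q \<noteq> 0"
    by auto
  moreover have "degree p = degree [:-z, 1:] + degree q"
    unfolding pq by (rule degree_mult_eq) (use \<open>q \<noteq> 0\<close> in auto)
  ultimately have q: "poly_mat_vec q B w \<noteq> 0"
    using p_min by fastforce
  have "p = pCons 0 q - smult z q"
    using pq by simp
  then have "B *v poly_mat_vec q B w - z *s poly_mat_vec q B w = 0"
    using p(2) by (simp add: poly_mat_vec_diff poly_mat_vec_smult poly_mat_vec_pCons_0)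
  with q show ?thesis
    by auto
qed

lemma funpow_matrix_vector_mult_commute:
  fixes A B :: "'a::field^'n^'n"
  assumes "A ** B = B ** A"
  shows "A *v ((*v) B ^^ i) w = ((*v) B ^^ i) (A *v w)"
proof (induction i)
  case (Suc i)
  have "A *v (B *v v) = B *v (A *v v)" for v
    by (metis assms matrix_vector_mul_assoc)
  with Suc.IH show ?case
    by simp
qed simp

lemma funpow_matrix_vector_mult_scale:
  fixes B :: "'a::field^'n^'n"
  shows "((*v) B ^^ i) (c *s w) = c *s ((*v) B ^^ i) w"
  by (induction i) (simp_all add: vector_scalar_commute)

lemma poly_mat_vec_eigenvector_of_commuting:
  assumes "A ** B = B ** A" "A *v w = c *s w"
  shows "A *v poly_mat_vec q B w = c *s poly_mat_vec q B w"
  using assms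
  by (simp add: poly_mat_vec_def vec.sum vector_scalar_commute funpow_matrix_vector_mult_commute
      funpow_matrix_vector_mult_scale vec.scale_sum_right vector_smult_assoc mult.commute)

lemma common_eigenvector_finite:
  fixes F :: "(complex^'n^'n) set"
  assumes "finite F" "\<And>A A'. A \<in> F \<Longrightarrow> A' \<in> F \<Longrightarrow> A ** A' = A' ** A"
  shows "\<exists>w. w \<noteq> 0 \<and> (\<forall>A\<in>F. \<exists>c. A *v w = c *s w)"
  using assms
proof (induction F rule: finite_induct)
  case empty
  have "(vec 1 :: complex^'n) \<noteq> 0"
    by (simp add: vec_eq_iff)
  then show ?case
    by blast
next
  case (insert B F)
  then obtain w where w: "w \<noteq> 0" "\<forall>A\<in>F. \<exists>c. A *v w = c *s w"
    by blast
  obtain q z where "poly_mat_vec q B w \<noteq> 0" "B *v poly_mat_vec q B w = z *s poly_mat_vec q B w"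
    using poly_mat_vec_eigenvector_exists[OF w(1)] by blast
  moreover have "\<exists>c. A *v poly_mat_vec q B w = c *s poly_mat_vec q B w" if "A \<in> F" for A
    using w(2) that insert.prems by (blast intro: poly_mat_vec_eigenvector_of_commuting)
  ultimately show ?case
    by blast
qed

lemma scaleR_matrix_vector_mult:
  fixes A :: "complex^'m^'n"
  shows "(r *\<^sub>R A) *v w = complex_of_real r *s (A *v w)"
  by (simp add: vec_eq_iff matrix_vector_mult_def sum_distrib_left)
     (simp add: scaleR_conv_of_real mult.assoc)

lemma subspace_matrices_with_eigenvector:
  "subspace {A::complex^'n^'n. \<exists>c. A *v w = c *s w}"
proof (unfold subspace_def, intro conjI ballI allI)
  show "0 \<in> {A::complex^'n^'n. \<exists>c. A *v w = c *s w}"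
    by (auto intro: exI[of _ 0])
next
  fix A A' assume "A \<in> {A. \<exists>c. A *v w = c *s w}" "A' \<in> {A. \<exists>c. A *v w = c *s w}"
  then obtain c c' where "A *v w = c *s w" "A' *v w = c' *s w"
    by blast
  then show "A + A' \<in> {A. \<exists>c. A *v w = c *s w}"
    by (auto simp: matrix_vector_mult_add_rdistrib vector_sadd_rdistrib intro: exI[of _ "c + c'"])
next
  fix r :: real and A assume "A \<in> {A. \<exists>c. A *v w = c *s w}"
  then show "r *\<^sub>R A \<in> {A. \<exists>c. A *v w = c *s w}"
    by (auto simp: scaleR_matrix_vector_mult vector_smult_assoc)
qed

lemma common_eigenvector:
  fixes S :: "(complex^'n^'n) set"
  assumes "\<And>A A'. A \<in> S \<Longrightarrow> A' \<in> S \<Longrightarrow> A ** A' = A' ** A"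
  shows "\<exists>w. w \<noteq> 0 \<and> (\<forall>A\<in>S. \<exists>c. A *v w = c *s w)"
proof -
  txt \<open>The matrices form a finite-dimensional real vector space, and having \<open>w\<close> as an
    eigenvector is a real-linear condition, so it suffices to treat a finite real basis of \<open>S\<close>.\<close>
  obtain B where B: "B \<subseteq> S" "independent B" "S \<subseteq> span B"
    by (metis basis_exists)
  have "finite B"
    using independent_bound B(2) by blast
  then obtain w where w: "w \<noteq> 0" "\<forall>A\<in>B. \<exists>c. A *v w = c *s w"
    using common_eigenvector_finite[of B] assms B(1) by blast
  have "span B \<subseteq> {A. \<exists>c. A *v w = c *s w}"
    using w(2) by (intro span_minimal subspace_matrices_with_eigenvector) auto
  with w(1) B(3) show ?thesis
    by blast
qed

section \<open>Scalar multiples and commutation of matrices\<close>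

lemma mat_smult_matrix_mul: "mat_smult c A ** B = mat_smult c (A ** B)"
  by (simp add: mat_smult_def matrix_matrix_mult_def vec_eq_iff sum_distrib_left mult.assoc)

lemma matrix_mul_mat_smult: "A ** mat_smult c B = mat_smult c (A ** B)"
  by (simp add: mat_smult_def matrix_matrix_mult_def vec_eq_iff sum_distrib_left mult.left_commute)

lemma mat_smult_mat_smult: "mat_smult a (mat_smult b A) = mat_smult (a * b) A"
  by (simp add: mat_smult_def vec_eq_iff mult.assoc)

lemma mat_smult_1 [simp]: "mat_smult 1 A = A"
  by (simp add: mat_smult_def vec_eq_iff)

lemma mat_smult_eq_iff:
  assumes "a \<noteq> 0"
  shows "mat_smult a A = B \<longleftrightarrow> A = mat_smult (1 / a) B"
  using assms by (auto simp: mat_smult_mat_smult)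

lemma mat_smult_matrix_vector_mult: "mat_smult c A *v w = c *s (A *v w)"
  by (simp add: mat_smult_def matrix_vector_mult_def vec_eq_iff sum_distrib_left mult.assoc)

lemma det_mat_smult: "det (mat_smult c A) = c ^ CARD('n) * det (A :: complex^'n^'n)"
proof -
  have "mat_smult c A = (\<chi> i. c *s A $ i)"
    by (simp add: mat_smult_def vec_eq_iff)
  then show ?thesis
    using det_rows_mul[of "\<lambda>_. c" "\<lambda>i. A $ i"] by simp
qed

lemma matrix_inv_right:
  assumes "invertible A"
  shows "A ** matrix_inv A = mat 1"
  using someI_ex[OF assms[unfolded invertible_def]] by (simp add: matrix_inv_def)

lemma matrix_inv_left:
  assumes "invertible A"
  shows "matrix_inv A ** A = mat 1"
  using someI_ex[OF assms[unfolded invertible_def]] by (simp add: matrix_inv_def)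

lemma matrix_add_rdistrib: "(A + B) ** C = A ** C + B ** C"
  by (vector matrix_matrix_mult_def sum.distrib[symmetric] field_simps)

lemma mat_smult_commute:
  assumes "A ** B = B ** A"
  shows "mat_smult c A ** B = B ** mat_smult c A"
  using assms by (simp add: mat_smult_matrix_mul matrix_mul_mat_smult)

lemma matrix_mul_commute_mul:
  assumes "A ** C = C ** A" "B ** C = C ** B"
  shows "(A ** B) ** C = C ** (A ** B)"
  by (metis assms matrix_mul_assoc)

lemma matrix_inv_commute:
  fixes A :: "'a::field^'n^'n"
  assumes "invertible A" "A ** B = B ** A"
  shows "matrix_inv A ** B = B ** matrix_inv A"
  by (metis assms matrix_inv_left matrix_inv_right matrix_mul_assoc matrix_mul_lid matrix_mul_rid)

lemma mult_matrix_inv_commutes_if_same_commutator_scalar: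
  fixes A X Y :: "complex^'n^'n"
  assumes "invertible Y" "c \<noteq> 0"
    and "X ** A = mat_smult c (A ** X)" "Y ** A = mat_smult c (A ** Y)"
  shows "(X ** matrix_inv Y) ** A = A ** (X ** matrix_inv Y)"
proof -
  let ?Y' = "matrix_inv Y"
  have "A ** ?Y' = ?Y' ** (Y ** A) ** ?Y'"
    by (simp add: matrix_mul_assoc matrix_inv_left matrix_inv_right assms(1))
  also have "\<dots> = mat_smult c (?Y' ** A ** (Y ** ?Y'))"
    by (simp add: assms(4) mat_smult_matrix_mul matrix_mul_mat_smult matrix_mul_assoc)
  also have "\<dots> = mat_smult c (?Y' ** A)"
    by (simp add: matrix_inv_right assms(1))
  finally have "?Y' ** A = mat_smult (1 / c) (A ** ?Y')"
    using assms(2) by (simp add: mat_smult_mat_smult)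
  then have "(X ** ?Y') ** A = X ** mat_smult (1 / c) (A ** ?Y')"
    by (simp flip: matrix_mul_assoc)
  also have "\<dots> = mat_smult (1 / c) (X ** A ** ?Y')"
    by (simp add: matrix_mul_mat_smult matrix_mul_assoc)
  also have "\<dots> = A ** (X ** ?Y')"
    using assms(2) by (simp add: assms(3) mat_smult_matrix_mul mat_smult_mat_smult matrix_mul_assoc)
  finally show ?thesis .
qed

lemma commutator_scalar_root_of_unity:
  fixes A X :: "complex^'n^'n"
  assumes "invertible X" "invertible A" "X ** A = mat_smult c (A ** X)"
  shows "c ^ CARD('n) = 1"
proof -
  have "det X * det A = c ^ CARD('n) * (det A * det X)"
    using arg_cong[OF assms(3), of det] by (simp add: det_mul det_mat_smult)
  moreover have "det X \<noteq> 0" "det A \<noteq> 0"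
    using assms(1,2) invertible_det_nz by auto
  ultimately show ?thesis
    by (simp add: mult.commute)
qed

lemma subspace_commutant: "subspace {A :: complex^'n^'n. Z ** A = A ** Z}"
  by (auto simp: subspace_def matrix_add_ldistrib matrix_add_rdistrib matrix_scalar_ac
      simp flip: scalar_matrix_assoc)

lemma commutes_with_span:
  fixes Z :: "complex^'n^'n"
  assumes "\<And>A. A \<in> B \<Longrightarrow> Z ** A = A ** Z" "A \<in> span B"
  shows "Z ** A = A ** Z"
  using span_minimal[OF _ subspace_commutant, of B Z] assms by blast

section \<open>Lifting projective representations of abelian groups\<close>

lemma invertible_eigenvalue_nonzero:
  fixes A :: "'a::field^'n^'n"
  assumes "invertible A" "w \<noteq> 0" "A *v w = c *s w"
  shows "c \<noteq> 0"
proof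
  assume "c = 0"
  have "w = (matrix_inv A ** A) *v w"
    by (simp add: matrix_inv_left assms(1))
  also have "\<dots> = 0"
    using assms(3) \<open>c = 0\<close> by (simp flip: matrix_vector_mul_assoc)
  finally show False
    using assms(2) by blast
qed

lemma finite_image_factorizing:
  assumes "finite (f ` A)" "\<And>x y. x \<in> A \<Longrightarrow> y \<in> A \<Longrightarrow> f x = f y \<Longrightarrow> g x = g y"
  shows "finite (g ` A)"
proof -
  have "g x = g (inv_into A f (f x))" if "x \<in> A" for x
    using that by (intro assms(2)) (simp_all add: inv_into_into f_inv_into_f)
  then have "g ` A = (\<lambda>v. g (inv_into A f v)) ` f ` A"
    by (simp add: image_image cong: image_cong)
  with assms(1) show ?thesis
    by simp
qed

lemma (in group) finite_rcosets_if_fibres_in_subgroup: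
  assumes "subgroup H G" "finite (f ` carrier G)"
    and "\<And>g g'. g \<in> carrier G \<Longrightarrow> g' \<in> carrier G \<Longrightarrow> f g = f g' \<Longrightarrow> g \<otimes> inv g' \<in> H"
  shows "finite (rcosets H)"
proof -
  have "finite ((\<lambda>g. H #> g) ` carrier G)"
  proof (rule finite_image_factorizing[OF assms(2)])
    fix g g' assume "g \<in> carrier G" "g' \<in> carrier G" "f g = f g'"
    then have "g \<in> H #> g'"
      using assms(3) subgroup.rcos_module_rev[OF assms(1) is_group] by blast
    with \<open>g' \<in> carrier G\<close> show "H #> g = H #> g'"
      using repr_independence[OF _ _ assms(1)] by metis
  qed
  then show ?thesis
    by (simp add: RCOSETS_def UNION_singleton_eq_range)
qed

lemma PU_hom_mult:
  assumes "PU_hom G U" "g \<in> carrier G" "h \<in> carrier G"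
  obtains c where "c \<noteq> 0" "U (g \<otimes>\<^bsub>G\<^esub> h) = mat_smult c (U g ** U h)"
  using assms unfolding PU_hom_def proj_eq_def by blast

lemma PU_hom_invertible:
  assumes "PU_hom G U" "g \<in> carrier G"
  shows "invertible (U g)"
  using assms unfolding PU_hom_def unitary_mat_def invertible_def by blast

lemma PU_hom_one:
  fixes G (structure) and U :: "'g \<Rightarrow> complex^'n^'n"
  assumes "monoid G" "PU_hom G U"
  obtains s where "U \<one>\<^bsub>G\<^esub> = mat_smult s (mat 1)"
proof -
  interpret monoid G by fact
  let ?I = "matrix_inv (U \<one>)"
  obtain a where a: "a \<noteq> 0" "U \<one> = mat_smult a (U \<one> ** U \<one>)"
    using PU_hom_mult[OF assms(2), of \<one> \<one>] by auto
  have inv: "U \<one> ** ?I = mat 1"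
    using PU_hom_invertible[OF assms(2)] by (simp add: matrix_inv_right)
  have "mat 1 = U \<one> ** ?I"
    by (simp add: inv)
  also have "\<dots> = mat_smult a (U \<one> ** U \<one>) ** ?I"
    by (rule arg_cong[where f = "\<lambda>X. X ** ?I"]) (rule a(2))
  also have "\<dots> = mat_smult a (U \<one>)"
    by (simp add: inv mat_smult_matrix_mul flip: matrix_mul_assoc)
  finally have "U \<one> = mat_smult (1 / a) (mat 1)"
    using a(1) by (simp add: mat_smult_mat_smult)
  then show ?thesis
    by (rule that)
qed

lemma PU_hom_inv:
  fixes G (structure) and U :: "'g \<Rightarrow> complex^'n^'n"
  assumes "group G" "PU_hom G U" "g \<in> carrier G"
  obtains t where "U (inv\<^bsub>G\<^esub> g) = mat_smult t (matrix_inv (U g))"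
proof -
  interpret group G by fact
  obtain s where s: "U \<one> = mat_smult s (mat 1)"
    using PU_hom_one[OF monoid_axioms assms(2)] by blast
  obtain b where b: "b \<noteq> 0" "U (inv g \<otimes> g) = mat_smult b (U (inv g) ** U g)"
    using PU_hom_mult[OF assms(2), of "inv g" g] assms(3) by auto
  have "mat_smult b (U (inv g) ** U g) = mat_smult s (mat 1)"
    using b(2) s assms(3) by simp
  then have inv_mult: "U (inv g) ** U g = mat_smult (s / b) (mat 1)"
    using b(1) by (simp add: mat_smult_eq_iff mat_smult_mat_smult)
  have "U (inv g) = (U (inv g) ** U g) ** matrix_inv (U g)"
    using PU_hom_invertible[OF assms(2,3)] by (simp add: matrix_inv_right flip: matrix_mul_assoc)
  also have "\<dots> = mat_smult (s / b) (mat 1) ** matrix_inv (U g)"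
    by (simp only: inv_mult)
  finally show ?thesis
    by (simp add: mat_smult_matrix_mul that)
qed

lemma PU_hom_commutator:
  fixes G (structure) and U :: "'g \<Rightarrow> complex^'n^'n"
  assumes "comm_group G" "PU_hom G U" "g \<in> carrier G" "h \<in> carrier G"
  obtains c where "c ^ CARD('n) = 1" "U g ** U h = mat_smult c (U h ** U g)"
proof -
  interpret comm_group G by fact
  obtain a where a: "a \<noteq> 0" "U (g \<otimes> h) = mat_smult a (U g ** U h)"
    using PU_hom_mult[OF assms(2-4)] by blast
  obtain b where b: "U (h \<otimes> g) = mat_smult b (U h ** U g)"
    using PU_hom_mult[OF assms(2,4,3)] by blast
  have "g \<otimes> h = h \<otimes> g"
    using m_comm assms(3,4) by blast
  then have "mat_smult a (U g ** U h) = mat_smult b (U h ** U g)"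
    using a(2) b by simp
  then have commutator: "U g ** U h = mat_smult (b / a) (U h ** U g)"
    using a(1) by (simp add: mat_smult_eq_iff mat_smult_mat_smult)
  show ?thesis
    by (rule that[OF commutator_scalar_root_of_unity[OF PU_hom_invertible[OF assms(2,3)]
          PU_hom_invertible[OF assms(2,4)] commutator] commutator])
qed

text \<open>The kernel of the commutator pairing \<open>(g, h) \<mapsto> c\<close>, where \<open>U g ** U h = c \<cdot> U h ** U g\<close>.\<close>

definition centralizing_subgroup :: "('g, 'b) monoid_scheme \<Rightarrow> ('g \<Rightarrow> complex^'n^'n) \<Rightarrow> 'g set" where
  "centralizing_subgroup G U = {g \<in> carrier G. \<forall>h\<in>carrier G. U g ** U h = U h ** U g}"

lemma mem_centralizing_subgroupI:
  assumes "g \<in> carrier G" "U g = mat_smult c Z" "\<And>h. h \<in> carrier G \<Longrightarrow> Z ** U h = U h ** Z"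
  shows "g \<in> centralizing_subgroup G U"
  using assms by (simp add: centralizing_subgroup_def mat_smult_commute)

lemma subgroup_centralizing_subgroup:
  fixes G (structure) and U :: "'g \<Rightarrow> complex^'n^'n"
  assumes "group G" "PU_hom G U"
  shows "subgroup (centralizing_subgroup G U) G"
proof -
  interpret group G by fact
  have central: "U a ** U h = U h ** U a" if "a \<in> centralizing_subgroup G U" "h \<in> carrier G" for a h
    using that by (simp add: centralizing_subgroup_def)
  show ?thesis
  proof (rule subgroupI)
    show "centralizing_subgroup G U \<subseteq> carrier G"
      by (auto simp: centralizing_subgroup_def)
    obtain s where "U \<one> = mat_smult s (mat 1)"
      using PU_hom_one[OF monoid_axioms assms(2)] .
    then have "\<one> \<in> centralizing_subgroup G U"
      by (rule mem_centralizing_subgroupI[OF one_closed]) simp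
    then show "centralizing_subgroup G U \<noteq> {}"
      by blast
  next
    fix a assume a: "a \<in> centralizing_subgroup G U"
    then have "a \<in> carrier G"
      by (simp add: centralizing_subgroup_def)
    then obtain t where "U (inv a) = mat_smult t (matrix_inv (U a))"
      using PU_hom_inv[OF is_group assms(2)] by blast
    then show "inv a \<in> centralizing_subgroup G U"
    proof (rule mem_centralizing_subgroupI[OF inv_closed[OF \<open>a \<in> carrier G\<close>]])
      fix h assume "h \<in> carrier G"
      then show "matrix_inv (U a) ** U h = U h ** matrix_inv (U a)"
        using PU_hom_invertible[OF assms(2) \<open>a \<in> carrier G\<close>] central[OF a]
        by (blast intro: matrix_inv_commute)
    qed
  next
    fix a b assume ab: "a \<in> centralizing_subgroup G U" "b \<in> centralizing_subgroup G U"
    then have "a \<in> carrier G" "b \<in> carrier G"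
      by (simp_all add: centralizing_subgroup_def)
    then obtain c where "U (a \<otimes> b) = mat_smult c (U a ** U b)"
      using PU_hom_mult[OF assms(2)] by metis
    then show "a \<otimes> b \<in> centralizing_subgroup G U"
    proof (rule mem_centralizing_subgroupI[OF m_closed[OF \<open>a \<in> carrier G\<close> \<open>b \<in> carrier G\<close>]])
      fix h assume "h \<in> carrier G"
      then show "(U a ** U b) ** U h = U h ** (U a ** U b)"
        using central[OF ab(1)] central[OF ab(2)] by (blast intro: matrix_mul_commute_mul)
    qed
  qed
qed

lemma mult_inv_mem_centralizing_subgroup:
  fixes G (structure) and U :: "'g \<Rightarrow> complex^'n^'n"
  assumes "group G" "PU_hom G U" "g \<in> carrier G" "g' \<in> carrier G"
    and "\<And>h. h \<in> carrier G \<Longrightarrow> (U g ** matrix_inv (U g')) ** U h = U h ** (U g ** matrix_inv (U g'))"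
  shows "g \<otimes> inv g' \<in> centralizing_subgroup G U"
proof -
  interpret group G by fact
  obtain t where t: "U (inv g') = mat_smult t (matrix_inv (U g'))"
    using PU_hom_inv[OF is_group assms(2,4)] .
  obtain a where "U (g \<otimes> inv g') = mat_smult a (U g ** U (inv g'))"
    using PU_hom_mult[OF assms(2,3) inv_closed[OF assms(4)]] .
  then have "U (g \<otimes> inv g') = mat_smult (a * t) (U g ** matrix_inv (U g'))"
    by (simp add: t matrix_mul_mat_smult mat_smult_mat_smult)
  then show ?thesis
    using assms(3-5) by (blast intro: mem_centralizing_subgroupI)
qed

lemma finite_rcosets_centralizing_subgroup:
  fixes G (structure) and U :: "'g \<Rightarrow> complex^'n^'n"
  assumes "comm_group G" "PU_hom G U"
  shows "finite (rcosets (centralizing_subgroup G U))"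
proof -
  interpret comm_group G by fact
  obtain B where B: "B \<subseteq> U ` carrier G" "independent B" "U ` carrier G \<subseteq> span B"
    by (metis basis_exists)
  have "finite B"
    using independent_bound B(2) by blast
  txt \<open>\<open>scalars g\<close> lists the commutator scalars of \<open>U g\<close> against a finite real basis of the
    span of \<open>U ` carrier G\<close>; by linearity they determine \<open>g\<close> modulo the centralizing subgroup.\<close>
  define scalars where
    "scalars g = {(A, c). A \<in> B \<and> c ^ CARD('n) = 1 \<and> U g ** A = mat_smult c (A ** U g)}" for g
  have "scalars ` carrier G \<subseteq> Pow (B \<times> {c. c ^ CARD('n) = 1})"
    by (auto simp: scalars_def)
  then have "finite (scalars ` carrier G)"
    by (rule finite_subset) (simp add: \<open>finite B\<close> finite_roots_unity)
  moreover have "g \<otimes> inv g' \<in> centralizing_subgroup G U"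
    if g: "g \<in> carrier G" and g': "g' \<in> carrier G" and eq: "scalars g = scalars g'" for g g'
  proof -
    let ?Z = "U g ** matrix_inv (U g')"
    have "?Z ** A = A ** ?Z" if "A \<in> B" for A
    proof -
      obtain h where h: "h \<in> carrier G" "A = U h"
        using \<open>A \<in> B\<close> B(1) by blast
      obtain c where c: "c ^ CARD('n) = 1" "U g ** A = mat_smult c (A ** U g)"
        using PU_hom_commutator[OF assms g h(1)] h(2) by metis
      then have "(A, c) \<in> scalars g"
        using \<open>A \<in> B\<close> by (simp add: scalars_def)
      then have "(A, c) \<in> scalars g'"
        by (simp only: eq)
      then have "U g' ** A = mat_smult c (A ** U g')"
        by (simp add: scalars_def)
      moreover have "c \<noteq> 0"
        using c(1) by (auto simp: power_0_left)
      ultimately show ?thesis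
        by (intro mult_matrix_inv_commutes_if_same_commutator_scalar
            [OF PU_hom_invertible[OF assms(2) g'] _ c(2)])
    qed
    moreover have "U h \<in> span B" if "h \<in> carrier G" for h
      using that B(3) by blast
    ultimately have "?Z ** U h = U h ** ?Z" if "h \<in> carrier G" for h
      using that by (blast intro: commutes_with_span)
    with g g' show ?thesis
      by (rule mult_inv_mem_centralizing_subgroup[OF is_group assms(2)])
  qed
  ultimately show ?thesis
    by (rule finite_rcosets_if_fibres_in_subgroup[OF subgroup_centralizing_subgroup[OF is_group assms(2)]])
qed

lemma GL_lift_on_if_commuting:
  fixes G (structure) and U :: "'g \<Rightarrow> complex^'n^'n"
  assumes "PU_hom G U" "subgroup M G"
    and "\<And>m m'. m \<in> M \<Longrightarrow> m' \<in> M \<Longrightarrow> U m ** U m' = U m' ** U m"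
  shows "\<exists>\<psi>. GL_lift_on G M U \<psi>"
proof -
  have "A ** A' = A' ** A" if "A \<in> U ` M" "A' \<in> U ` M" for A A'
    using that assms(3) by blast
  then obtain w where w: "w \<noteq> 0" "\<forall>A\<in>U ` M. \<exists>c. A *v w = c *s w"
    using common_eigenvector[of "U ` M"] by blast
  define eigenvalue where "eigenvalue m = (SOME c. U m *v w = c *s w)" for m
  have eigenvalue: "U m *v w = eigenvalue m *s w" if "m \<in> M" for m
    unfolding eigenvalue_def by (rule someI_ex) (use w(2) that in blast)
  have invertible: "invertible (U m)" if "m \<in> M" for m
    using PU_hom_invertible[OF assms(1)] subgroup.mem_carrier[OF assms(2) that] .
  have eigenvalue_nonzero: "eigenvalue m \<noteq> 0" if "m \<in> M" for m
    by (rule invertible_eigenvalue_nonzero[OF invertible[OF that] w(1) eigenvalue[OF that]])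
  define \<psi> where "\<psi> m = mat_smult (1 / eigenvalue m) (U m)" for m
  have "\<psi> (m \<otimes> m') = \<psi> m ** \<psi> m'" if m: "m \<in> M" and m': "m' \<in> M" for m m'
  proof -
    obtain a where a: "a \<noteq> 0" "U (m \<otimes> m') = mat_smult a (U m ** U m')"
      using PU_hom_mult[OF assms(1) subgroup.mem_carrier[OF assms(2) m]
          subgroup.mem_carrier[OF assms(2) m']] .
    have "eigenvalue (m \<otimes> m') *s w = U (m \<otimes> m') *v w"
      by (rule eigenvalue[OF subgroup.m_closed[OF assms(2) m m'], symmetric])
    also have "\<dots> = a *s (U m *v (U m' *v w))"
      by (simp add: a(2) mat_smult_matrix_vector_mult matrix_vector_mul_assoc)
    also have "\<dots> = (a * eigenvalue m * eigenvalue m') *s w"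
      by (simp add: eigenvalue[OF m] eigenvalue[OF m'] vector_scalar_commute mult.commute
          mult.left_commute)
    finally have "eigenvalue (m \<otimes> m') = a * eigenvalue m * eigenvalue m'"
      using w(1) by simp
    then show ?thesis
      using a eigenvalue_nonzero[OF m] eigenvalue_nonzero[OF m']
      by (simp add: \<psi>_def mat_smult_matrix_mul matrix_mul_mat_smult mat_smult_mat_smult
          mult.commute)
  qed
  moreover have "invertible (\<psi> m)" if "m \<in> M" for m
    using invertible[OF that] eigenvalue_nonzero[OF that]
    by (simp add: \<psi>_def invertible_det_nz det_mat_smult)
  moreover have "proj_eq (\<psi> m) (U m)" if "m \<in> M" for m
    unfolding \<psi>_def proj_eq_def using eigenvalue_nonzero[OF that]
    by (intro exI[of _ "1 / eigenvalue m"]) simp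
  ultimately show ?thesis
    unfolding GL_lift_on_def by blast
qed

theorem proposition4p6:
  fixes G :: "('g, 'b) monoid_scheme" and U :: "'g \<Rightarrow> complex^'n^'n"
  assumes "comm_group G"
    and "PU_hom G U"
  shows "\<exists>M. subgroup M G \<and> finite (rcosets\<^bsub>G\<^esub> M) \<and> (\<exists>\<psi>. GL_lift_on G M U \<psi>)"
proof -
  interpret comm_group G by fact
  let ?M = "centralizing_subgroup G U"
  have "subgroup ?M G"
    using subgroup_centralizing_subgroup[OF is_group assms(2)] .
  moreover have "finite (rcosets\<^bsub>G\<^esub> ?M)"
    using finite_rcosets_centralizing_subgroup[OF assms] .
  moreover have "\<exists>\<psi>. GL_lift_on G ?M U \<psi>"
    by (rule GL_lift_on_if_commuting[OF assms(2) \<open>subgroup ?M G\<close>])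
       (unfold centralizing_subgroup_def, blast)
  ultimately show ?thesis
    by blast
qed

end
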